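(* Let $d\in\mathbb N$. For $\beta>0$, $\alpha<0$ and $a\ge0$ one has $\Delta(\beta,\alpha)=\Delta^{\mathrm{CMF}}(\beta,\alpha)=0$, and for $\beta>0$, $\alpha=0$ and $a\ge0$, $$\Delta(\beta,0)=\Delta^{\mathrm{CMF}}(\beta,0)=\begin{cases}+\infty,&d=1,2,\\0,&d\ge3.\end{cases}$$
   Context: $|\Lambda_N|=(2N)^d$ for $N\in\mathbb N=\{1,2,\dots\}$; for $\alpha\le 0$, $q_k^{(\alpha)}=\frac{e^{\beta k\alpha}}{(4\pi\beta)^{d/2}k^{1+d/2}}$, $k\in\mathbb N$. $\ell_1(\mathbb R_+)$ is the space of nonnegative summable real sequences. Let $(\mathcal N_k)_{k\in\mathbb N}$ be independent Poisson random variables, $\mathcal N_k$ with parameter $|\Lambda_N|q_k^{(\alpha)}$; $\nu_{N,\alpha}$ denotes the law on $\ell_1(\mathbb R_+)$ of $(\mathcal N_k/|\Lambda_N|)_{k\in\mathbb N}$. The cycle-mean-field measure is $$\nu^{\mathrm{CMF}}_{N,\alpha}(\mathrm dx)=\frac{e^{-\beta|\Lambda_N|H^{\mathrm{CMF}}(x)}}{\mathbb E_{\nu_{N,\alpha}}[e^{-\beta|\Lambda_N|H^{\mathrm{CMF}}}]}\nu_{N,\alpha}(\mathrm dx),\qquad H^{\mathrm{CMF}}(x)=\frac a2\Big(\sum_{k\ge1}x_k\Big)^2.$$ With $D(x)=\sum_{k=1}^\infty kx_k$ and $D_K(x)=\sum_{k=1}^Kkx_k$ (so $D-D_K=\sum_{k>K}kx_k$),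 define $$\Delta(\beta,\alpha)=\lim_{K\to\infty}\lim_{N\to\infty}\mathbb E_{\nu_{N,\alpha}}[D-D_K],\qquad \Delta^{\mathrm{CMF}}(\beta,\alpha)=\lim_{K\to\infty}\lim_{N\to\infty}\mathbb E_{\nu^{\mathrm{CMF}}_{N,\alpha}}[D-D_K].$$ *)

theory Defs
  imports "HOL-Probability.Probability"
begin

text \<open>
  Sequences indexed by \<open>k = 1, 2, \<dots>\<close> are functions \<open>nat \<Rightarrow> 'a\<close> that are extensional on
  \<open>{1..}\<close>, as in the product measure over that index set.  The value at index \<open>0\<close> is junk
  and no definition below depends on it.
\<close>

definition vol :: "nat \<Rightarrow> nat \<Rightarrow> real" where
  "vol d N = (2 * real N) ^ d"

definition q :: "nat \<Rightarrow> real \<Rightarrow> real \<Rightarrow> nat \<Rightarrow> real" where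
  "q d \<beta> \<alpha> k =
     exp (\<beta> * real k * \<alpha>) / ((4 * pi * \<beta>) powr (real d / 2) * real k powr (1 + real d / 2))"

definition seq_space :: "(nat \<Rightarrow> real) measure" where
  "seq_space = PiM {1..} (\<lambda>_. borel)"

definition ell1 :: "(nat \<Rightarrow> real) set" where
  "ell1 = {x \<in> space seq_space. (\<forall>k\<ge>1. 0 \<le> x k) \<and> summable (\<lambda>k. x (Suc k))}"

definition poisson_counts :: "nat \<Rightarrow> nat \<Rightarrow> real \<Rightarrow> real \<Rightarrow> (nat \<Rightarrow> nat) measure" where
  "poisson_counts d N \<beta> \<alpha> = PiM {1..} (\<lambda>k. measure_pmf (poisson_pmf (vol d N * q d \<beta> \<alpha> k)))"

text \<open>
  The rescaled sequence is summable only almost surely, so its law is formed on the space of all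
  sequences and then restricted to \<open>ell1\<close>, which has full measure (\<open>prob_space_nu\<close> below).  The
  trace of the product sigma-algebra on \<open>ell1\<close> is the Borel sigma-algebra of the norm.
\<close>

definition nu :: "nat \<Rightarrow> nat \<Rightarrow> real \<Rightarrow> real \<Rightarrow> (nat \<Rightarrow> real) measure" where
  "nu d N \<beta> \<alpha> = restrict_space
     (distr (poisson_counts d N \<beta> \<alpha>) seq_space (\<lambda>n. \<lambda>k\<in>{1..}. real (n k) / vol d N)) ell1"

definition H_CMF :: "real \<Rightarrow> (nat \<Rightarrow> real) \<Rightarrow> real" where
  "H_CMF a x = a / 2 * (\<Sum>k. x (Suc k))\<^sup>2"

definition Z_CMF :: "nat \<Rightarrow> nat \<Rightarrow> real \<Rightarrow> real \<Rightarrow> real \<Rightarrow> real" where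
  "Z_CMF d N \<beta> \<alpha> a = (\<integral>x. exp (- \<beta> * vol d N * H_CMF a x) \<partial>nu d N \<beta> \<alpha>)"

definition nu_CMF :: "nat \<Rightarrow> nat \<Rightarrow> real \<Rightarrow> real \<Rightarrow> real \<Rightarrow> (nat \<Rightarrow> real) measure" where
  "nu_CMF d N \<beta> \<alpha> a = density (nu d N \<beta> \<alpha>)
     (\<lambda>x. ennreal (exp (- \<beta> * vol d N * H_CMF a x) / Z_CMF d N \<beta> \<alpha> a))"

text \<open>
  \<open>Dens\<close> may be infinite on \<open>ell1\<close>, hence the values in \<open>[0, \<infinity>]\<close>.  Its summand for \<open>k = 0\<close>
  vanishes.  \<open>Dens_upto K\<close> is always finite, so the difference \<open>Dens x - Dens_upto K x\<close> is the
  tail sum over \<open>k > K\<close>, also when \<open>Dens x = \<infinity>\<close>.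
\<close>

definition Dens :: "(nat \<Rightarrow> real) \<Rightarrow> ennreal" where
  "Dens x = (\<Sum>k. ennreal (real k * x k))"

definition Dens_upto :: "nat \<Rightarrow> (nat \<Rightarrow> real) \<Rightarrow> ennreal" where
  "Dens_upto K x = (\<Sum>k=1..K. ennreal (real k * x k))"

definition tail_mean :: "(nat \<Rightarrow> real) measure \<Rightarrow> nat \<Rightarrow> ennreal" where
  "tail_mean M K = (\<integral>\<^sup>+x. (Dens x - Dens_upto K x) \<partial>M)"

text \<open>
  \<open>lim\<close> is a definite description and carries no information about existence, which is therefore
  a separate predicate.  Convergence is in \<open>[0, \<infinity>]\<close>, so the limit \<open>\<infinity>\<close> is allowed.
\<close>

definition iterated_lim :: "(nat \<Rightarrow> nat \<Rightarrow> ennreal) \<Rightarrow> ennreal" where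
  "iterated_lim E = lim (\<lambda>K. lim (\<lambda>N. E K N))"

definition iterated_lim_exists :: "(nat \<Rightarrow> nat \<Rightarrow> ennreal) \<Rightarrow> bool" where
  "iterated_lim_exists E \<longleftrightarrow>
     (\<forall>K\<ge>1. convergent (\<lambda>N. E K N)) \<and> convergent (\<lambda>K. lim (\<lambda>N. E K N))"

definition Delta :: "nat \<Rightarrow> real \<Rightarrow> real \<Rightarrow> ennreal" where
  "Delta d \<beta> \<alpha> = iterated_lim (\<lambda>K N. tail_mean (nu d N \<beta> \<alpha>) K)"

definition Delta_exists :: "nat \<Rightarrow> real \<Rightarrow> real \<Rightarrow> bool" where
  "Delta_exists d \<beta> \<alpha> \<longleftrightarrow> iterated_lim_exists (\<lambda>K N. tail_mean (nu d N \<beta> \<alpha>) K)"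

definition Delta_CMF :: "nat \<Rightarrow> real \<Rightarrow> real \<Rightarrow> real \<Rightarrow> ennreal" where
  "Delta_CMF d \<beta> \<alpha> a = iterated_lim (\<lambda>K N. tail_mean (nu_CMF d N \<beta> \<alpha> a) K)"

definition Delta_CMF_exists :: "nat \<Rightarrow> real \<Rightarrow> real \<Rightarrow> real \<Rightarrow> bool" where
  "Delta_CMF_exists d \<beta> \<alpha> a \<longleftrightarrow> iterated_lim_exists (\<lambda>K N. tail_mean (nu_CMF d N \<beta> \<alpha> a) K)"

lemma vol_pos: "1 \<le> N \<Longrightarrow> 0 < vol d N"
  by (simp add: vol_def)

lemma q_pos: "0 < \<beta> \<Longrightarrow> 1 \<le> k \<Longrightarrow> 0 < q d \<beta> \<alpha> k"
  by (simp add: q_def)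

lemma summable_q:
  assumes "1 \<le> d" "0 < \<beta>" "\<alpha> \<le> 0"
  shows "summable (\<lambda>k. q d \<beta> \<alpha> (Suc k))"
proof -
  let ?c = "(4 * pi * \<beta>) powr (real d / 2)"
  have "summable (\<lambda>k. real k powr (- (1 + real d / 2)))"
    using assms by (subst summable_real_powr_iff) auto
  then have "summable (\<lambda>k. real (Suc k) powr (- (1 + real d / 2)))"
    by (subst summable_Suc_iff)
  then have s: "summable (\<lambda>k. inverse ?c * real (Suc k) powr (- (1 + real d / 2)))"
    by (rule summable_mult)
  show ?thesis
  proof (rule summable_comparison_test'[OF s])
    fix k :: nat
    have "\<beta> * real (Suc k) * \<alpha> \<le> 0"
      using assms by (intro mult_nonneg_nonpos) auto
    then have "exp (\<beta> * real (Suc k) * \<alpha>) \<le> 1" by simp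
    moreover have "0 < ?c * real (Suc k) powr (1 + real d / 2)"
      using assms by simp
    ultimately have "exp (\<beta> * real (Suc k) * \<alpha>) / (?c * real (Suc k) powr (1 + real d / 2))
        \<le> 1 / (?c * real (Suc k) powr (1 + real d / 2))"
      by (intro divide_right_mono) auto
    also have "\<dots> = inverse ?c * real (Suc k) powr (- (1 + real d / 2))"
      by (simp only: powr_minus divide_inverse inverse_mult_distrib mult_1)
    finally have "q d \<beta> \<alpha> (Suc k) \<le> inverse ?c * real (Suc k) powr (- (1 + real d / 2))"
      unfolding q_def .
    moreover have "0 < q d \<beta> \<alpha> (Suc k)"
      using assms by (intro q_pos) auto
    ultimately show "norm (q d \<beta> \<alpha> (Suc k)) \<le> inverse ?c * real (Suc k) powr (- (1 + real d / 2))"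
      by (simp only: real_norm_def abs_of_pos)
  qed
qed

lemma nn_integral_poisson:
  assumes "0 < r"
  shows "(\<integral>\<^sup>+n. ennreal (real n) \<partial>measure_pmf (poisson_pmf r)) = ennreal r"
proof -
  have "(\<lambda>n. r ^ n /\<^sub>R fact n) sums exp r"
    by (rule exp_converges)
  then have "(\<lambda>n. r * exp (- r) * (r ^ n /\<^sub>R fact n)) sums (r * exp (- r) * exp r)"
    by (rule sums_mult)
  then have *: "(\<lambda>n. r * exp (- r) * (r ^ n / fact n)) sums r"
    by (simp add: exp_minus field_simps)
  have "(\<lambda>n. pmf (poisson_pmf r) (Suc n) * real (Suc n)) sums r"
  proof (rule sums_cong[THEN iffD1, OF _ *])
    fix n
    show "r * exp (- r) * (r ^ n / fact n) = pmf (poisson_pmf r) (Suc n) * real (Suc n)"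
      using assms by (simp add: divide_simps del: of_nat_Suc)
  qed
  then have "(\<lambda>n. pmf (poisson_pmf r) n * real n) sums r"
    by (subst (asm) sums_Suc_iff) simp
  then have "(\<Sum>n. ennreal (pmf (poisson_pmf r) n * real n)) = ennreal r"
    by (intro suminf_ennreal_eq) auto
  then show ?thesis
    by (simp add: nn_integral_measure_pmf nn_integral_count_space_nat ennreal_mult)
qed

lemma ell1_sets: "ell1 \<in> sets seq_space"
proof -
  have [measurable]: "(\<lambda>x. x k) \<in> borel_measurable seq_space" if "1 \<le> k" for k
    unfolding seq_space_def using that by (intro measurable_component_singleton) auto
  have "{x \<in> space seq_space. 0 \<le> x k} \<in> sets seq_space" if "1 \<le> k" for k
    using that by measurable
  then have nonneg: "{x \<in> space seq_space. \<forall>k. 1 \<le> k \<longrightarrow> 0 \<le> x k} \<in> sets seq_space"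
    by (intro sets.sets_Collect_countable_All) (auto intro: sets.sets_Collect_imp)
  have summ: "{x \<in> space seq_space. summable (\<lambda>k. x (Suc k))} \<in> sets seq_space"
    unfolding summable_iff_convergent Cauchy_convergent_iff[symmetric]
    by (intro sets_Collect_Cauchy borel_measurable_sum) simp
  have eq: "ell1 = {x \<in> space seq_space. \<forall>k. 1 \<le> k \<longrightarrow> 0 \<le> x k}
      \<inter> {x \<in> space seq_space. summable (\<lambda>k. x (Suc k))}"
    by (auto simp: ell1_def)
  show ?thesis
    unfolding eq using nonneg summ by (rule sets.Int)
qed

lemma prob_space_nu:
  assumes "1 \<le> d" "0 < \<beta>" "\<alpha> \<le> 0" "1 \<le> N"
  shows "prob_space (nu d N \<beta> \<alpha>)"
proof -
  let ?P = "poisson_counts d N \<beta> \<alpha>"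
  let ?M = "\<lambda>k. measure_pmf (poisson_pmf (vol d N * q d \<beta> \<alpha> k))"
  let ?X = "\<lambda>n. \<lambda>k\<in>{1..}. real (n k) / vol d N"
  interpret product_prob_space ?M "{1..}"
    by unfold_locales
  have P: "prob_space ?P"
    unfolding poisson_counts_def by (rule prob_space_axioms)
  have c: "(\<lambda>n. n k) \<in> measurable ?P (?M k)" if "1 \<le> k" for k
    unfolding poisson_counts_def using that by (intro measurable_component_singleton) auto
  have c': "(\<lambda>n. f (n k)) \<in> borel_measurable ?P" if "1 \<le> k"
    for k and f :: "nat \<Rightarrow> 'b::topological_space"
    by (rule measurable_compose[OF c[OF that]]) simp
  have X: "?X \<in> measurable ?P seq_space"
    unfolding seq_space_def by (rule measurable_restrict) (auto intro: c')
  have r: "0 < vol d N * q d \<beta> \<alpha> (Suc k)" for k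
    using assms by (intro mult_pos_pos vol_pos q_pos) auto
  have mean: "(\<integral>\<^sup>+n. ennreal (real (n (Suc k))) \<partial>?P) = ennreal (vol d N * q d \<beta> \<alpha> (Suc k))" for k
  proof -
    have "distr ?P (?M (Suc k)) (\<lambda>n. n (Suc k)) = ?M (Suc k)"
      unfolding poisson_counts_def by (rule PiM_component) auto
    then have "(\<integral>\<^sup>+n. ennreal (real n) \<partial>?M (Suc k))
        = (\<integral>\<^sup>+n. ennreal (real n) \<partial>distr ?P (?M (Suc k)) (\<lambda>n. n (Suc k)))"
      by simp
    also have "\<dots> = (\<integral>\<^sup>+n. ennreal (real (n (Suc k))) \<partial>?P)"
      by (rule nn_integral_distr[OF c]) auto
    finally show ?thesis
      using nn_integral_poisson[OF r[of k]] by simp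
  qed
  have "(\<integral>\<^sup>+n. (\<Sum>k. ennreal (real (n (Suc k)))) \<partial>?P) = (\<Sum>k. ennreal (vol d N * q d \<beta> \<alpha> (Suc k)))"
    by (subst nn_integral_suminf) (auto intro: c' simp: mean)
  also have "\<dots> = ennreal (\<Sum>k. vol d N * q d \<beta> \<alpha> (Suc k))"
    using r summable_mult[OF summable_q[OF assms(1-3)], of "vol d N"]
    by (intro suminf_ennreal2) (auto intro: less_imp_le)
  finally have "(\<integral>\<^sup>+n. (\<Sum>k. ennreal (real (n (Suc k)))) \<partial>?P) \<noteq> \<infinity>"
    by simp
  then have "AE n in ?P. (\<Sum>k. ennreal (real (n (Suc k)))) \<noteq> \<infinity>"
    by (intro nn_integral_PInf_AE) (auto intro!: borel_measurable_suminf_order c')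
  then have ae: "AE n in ?P. ?X n \<in> ell1"
  proof (rule AE_mp, intro AE_I2 impI)
    fix n assume n: "n \<in> space ?P" and "(\<Sum>k. ennreal (real (n (Suc k)))) \<noteq> \<infinity>"
    then have "summable (\<lambda>k. real (n (Suc k)))"
      by (intro summable_suminf_not_top) auto
    then have "summable (\<lambda>k. real (n (Suc k)) / vol d N)"
      by (rule summable_divide)
    moreover have "?X n \<in> space seq_space"
      using measurable_space[OF X n] .
    ultimately show "?X n \<in> ell1"
      using vol_pos[OF assms(4), of d] by (auto simp: ell1_def)
  qed
  let ?L = "distr ?P seq_space ?X"
  have L: "prob_space ?L"
    using P X by (rule prob_space.prob_space_distr)
  have "AE x in ?L. x \<in> ell1"
    using ae ell1_sets sets.sets_into_space[OF ell1_sets]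
    by (subst AE_distr_iff[OF X]) (auto simp: Int_absorb1 Int_def[symmetric] Collect_conj_eq)
  then have "emeasure ?L ell1 = 1"
    using L ell1_sets by (intro prob_space.emeasure_eq_1_AE) auto
  then show ?thesis
    unfolding nu_def using ell1_sets sets.sets_into_space[OF ell1_sets]
    by (intro prob_spaceI) (simp add: emeasure_restrict_space space_restrict_space Int_absorb2)
qed

end

theory Submission
  imports Defs
begin

text \<open>
  Write \<open>V\<close> for the volume, \<open>S\<close> for the total number of cycles, i.e. \<open>V\<close> times the sum of
  the sequence, and \<open>Q\<close> for the sum of all \<open>q k\<close>.  The interaction sees the configuration only
  through \<open>S\<close>: the density of the cycle-mean-field measure is proportional to \<open>f S\<close> with
  \<open>f s = exp (- c * s\<^sup>2 / V)\<close> and \<open>c = \<beta> * a / 2\<close>.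

  The characteristic identity of the Poisson law, applied to the \<open>k\<close>-th count, trades the factor
  \<open>V * x k\<close> for \<open>V * q k\<close> and adds one cycle, \<open>E[V x\<^sub>k G(S)] = V q\<^sub>k E[G(S + 1)]\<close>
  (\<open>nn_integral_nu_shift\<close>).  With \<open>G = f\<close>, summation over the lengths beyond \<open>K\<close> shows that the
  expected tail is a product (\<open>tail_mean_nu_CMF\<close>): the deterministic sum of \<open>k * q k\<close> over
  \<open>k > K\<close>, independent of the volume and of \<open>a\<close>, times \<open>R = E[f(S + 1)] / E[f(S)]\<close>, independent
  of \<open>K\<close>.  Expectations here are taken under the reference measure \<open>nu\<close>.

  It remains to see that \<open>R\<close> converges to a positive number as the volume grows.  Summing the
  identity over all \<open>k\<close> gives \<open>E[S G(S)] = V Q E[G(S + 1)]\<close>, so \<open>Q * R\<close> is the mean of \<open>S / V\<close>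
  under the law tilted by \<open>f\<close>.  With \<open>G s = f s * (s / V - m)\<close> the identity bounds the second
  moment of \<open>S / V - m\<close> under the tilted law by a constant over \<open>V\<close>, where \<open>m > 0\<close> solves
  \<open>m = Q * exp (- 2 * c * m)\<close> (\<open>tilted_shift_ratio\<close>); hence \<open>R\<close> tends to \<open>m / Q\<close>.

  Thus both limits vanish or are infinite according to whether the sum of \<open>k * q k\<close> converges.
  The summand is a constant times \<open>exp (\<beta> * k * \<alpha>) * k powr (- d / 2)\<close>: it is dominated by a
  geometric series for \<open>\<alpha> < 0\<close>, and for \<open>\<alpha> = 0\<close> the sum converges exactly when \<open>d \<ge> 3\<close>.  The
  measure without interaction is the case \<open>a = 0\<close>.
\<close>

section \<open>The shift identity for Poisson variables\<close>

text \<open>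
  The weights satisfy \<open>(n + 1) * p (n + 1) = r * p n\<close>; the identity is this relation summed
  against \<open>g\<close>.
\<close>

lemma nn_integral_poisson_shift:
  fixes g :: "nat \<Rightarrow> ennreal"
  assumes "0 < r"
  shows "(\<integral>\<^sup>+n. of_nat n * g n \<partial>measure_pmf (poisson_pmf r))
           = ennreal r * (\<integral>\<^sup>+n. g (Suc n) \<partial>measure_pmf (poisson_pmf r))"
proof -
  let ?p = "\<lambda>n. ennreal (pmf (poisson_pmf r) n)"
  have step: "?p (Suc n) * of_nat (Suc n) = ennreal r * ?p n" for n
  proof -
    have "pmf (poisson_pmf r) (Suc n) * real (Suc n) = r * pmf (poisson_pmf r) n"
      using assms by (simp add: divide_simps del: of_nat_Suc)
    moreover have "of_nat (Suc n) = ennreal (real (Suc n))"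
      by (simp only: ennreal_of_nat_eq_real_of_nat)
    ultimately show ?thesis
      using assms by (metis ennreal_mult pmf_nonneg of_nat_0_le_iff less_imp_le)
  qed
  have "(\<integral>\<^sup>+n. of_nat n * g n \<partial>measure_pmf (poisson_pmf r)) = (\<Sum>n. ?p n * (of_nat n * g n))"
    by (simp add: nn_integral_measure_pmf nn_integral_count_space_nat)
  also have "\<dots> = (\<Sum>n. ?p (Suc n) * (of_nat (Suc n) * g (Suc n)))"
    by (subst suminf_offset[where i = 1]) (auto simp del: of_nat_Suc)
  also have "\<dots> = (\<Sum>n. ennreal r * (?p n * g (Suc n)))"
    by (intro suminf_cong) (simp only: mult.assoc[symmetric] step)
  also have "\<dots> = ennreal r * (\<integral>\<^sup>+n. g (Suc n) \<partial>measure_pmf (poisson_pmf r))"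
    by (simp add: nn_integral_measure_pmf nn_integral_count_space_nat)
  finally show ?thesis .
qed

text \<open>
  Splitting off the \<open>k\<close>-th factor of the product reduces this to one Poisson variable, with the
  other coordinates frozen by Tonelli.
\<close>

lemma nn_integral_PiM_poisson_shift:
  fixes r :: "'i \<Rightarrow> real" and I :: "'i set"
  defines "P \<equiv> PiM I (\<lambda>i. measure_pmf (poisson_pmf (r i)))"
  assumes k: "k \<in> I" "0 < r k" and F [measurable]: "F \<in> borel_measurable P"
  shows "(\<integral>\<^sup>+n. of_nat (n k) * F n \<partial>P) = ennreal (r k) * (\<integral>\<^sup>+n. F (n(k := Suc (n k))) \<partial>P)"
proof -
  let ?M = "\<lambda>i. measure_pmf (poisson_pmf (r i))"
  let ?R = "PiM (I - {k}) ?M"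
  let ?u = "\<lambda>(m, n). n(k := m)"
  have ins: "insert k (I - {k}) = I"
    using k by auto
  have split: "P = distr (?M k \<Otimes>\<^sub>M ?R) P ?u"
    using distr_pair_PiM_eq_PiM[of "I - {k}" ?M k] unfolding ins P_def
    by (simp add: prob_space_measure_pmf)
  have u [measurable]: "?u \<in> measurable (?M k \<Otimes>\<^sub>M ?R) P"
    unfolding P_def split_beta' by (rule measurable_fun_upd[where J = "I - {k}"]) (use ins in auto)
  have inc [measurable]: "(\<lambda>n. n(k := Suc (n k))) \<in> measurable P P"
    unfolding P_def 
    by (rule measurable_fun_upd[where J = "I", OF _ measurable_ident_sets])
      (use k in \<open>auto intro: measurable_compose[OF measurable_component_singleton]\<close>)
  have comp [measurable]: "(\<lambda>n. of_nat (n k) :: ennreal) \<in> borel_measurable P"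
    unfolding P_def using k by (intro measurable_compose[OF measurable_component_singleton]) auto
  interpret R: prob_space ?R
    by (intro prob_space_PiM prob_space_measure_pmf)
  interpret pair_sigma_finite "?M k" ?R
    by (intro pair_sigma_finite.intro prob_space_imp_sigma_finite prob_space_measure_pmf R.prob_space_axioms)
  have pull: "(\<integral>\<^sup>+n. G n \<partial>P) = (\<integral>\<^sup>+n. \<integral>\<^sup>+m. G (n(k := m)) \<partial>?M k \<partial>?R)"
    if G [measurable]: "G \<in> borel_measurable P" for G :: "_ \<Rightarrow> ennreal"
  proof -
    have "(\<integral>\<^sup>+n. G n \<partial>P) = (\<integral>\<^sup>+n. G n \<partial>distr (?M k \<Otimes>\<^sub>M ?R) P ?u)"
      by (subst split) (rule refl)
    also have "\<dots> = (\<integral>\<^sup>+z. G (?u z) \<partial>(?M k \<Otimes>\<^sub>M ?R))"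
      by (rule nn_integral_distr) (auto intro: u)
    also have "\<dots> = (\<integral>\<^sup>+n. \<integral>\<^sup>+m. G (?u (m, n)) \<partial>?M k \<partial>?R)"
      by (rule nn_integral_snd[symmetric]) measurable
    finally show ?thesis by simp
  qed
  have "(\<integral>\<^sup>+n. of_nat (n k) * F n \<partial>P) = (\<integral>\<^sup>+n. \<integral>\<^sup>+m. of_nat m * F (n(k := m)) \<partial>?M k \<partial>?R)"
    by (subst pull) auto
  also have "\<dots> = (\<integral>\<^sup>+n. ennreal (r k) * (\<integral>\<^sup>+m. F (n(k := Suc m)) \<partial>?M k) \<partial>?R)"
    using k by (simp add: nn_integral_poisson_shift)
  also have "\<dots> = ennreal (r k) * (\<integral>\<^sup>+n. \<integral>\<^sup>+m. F (n(k := Suc m)) \<partial>?M k \<partial>?R)"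
  proof (rule nn_integral_cmult)
    have "(\<lambda>(n, m). F ((n(k := m))(k := Suc ((n(k := m)) k)))) \<in> borel_measurable (?R \<Otimes>\<^sub>M ?M k)"
      using measurable_compose[OF measurable_compose[OF measurable_pair_swap'[of ?R "?M k"] u] measurable_compose[OF inc F]]
      by (simp add: split_beta')
    then show "(\<lambda>n. \<integral>\<^sup>+m. F (n(k := Suc m)) \<partial>?M k) \<in> borel_measurable ?R"
      by (intro sigma_finite_measure.borel_measurable_nn_integral
          prob_space_imp_sigma_finite prob_space_measure_pmf) simp
  qed
  also have "(\<integral>\<^sup>+n. \<integral>\<^sup>+m. F (n(k := Suc m)) \<partial>?M k \<partial>?R) = (\<integral>\<^sup>+n. F (n(k := Suc (n k))) \<partial>P)"
    by (subst pull) auto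
  finally show ?thesis .
qed

text \<open>
  For a natural-valued \<open>S\<close> on a probability space this identity characterises the Poisson law with
  parameter \<open>l\<close>.  In this form it passes from the counts to their infinite sum by linearity.
\<close>

definition poisson_shift :: "'a measure \<Rightarrow> ('a \<Rightarrow> real) \<Rightarrow> real \<Rightarrow> bool" where
  "poisson_shift M S l \<longleftrightarrow> (\<forall>G\<in>borel_measurable borel.
     (\<integral>\<^sup>+x. ennreal (S x) * G (S x) \<partial>M) = ennreal l * (\<integral>\<^sup>+x. G (S x + 1) \<partial>M))"

lemma poisson_shift_integral:
  fixes G :: "real \<Rightarrow> real"
  assumes "poisson_shift M S l" and [measurable]: "S \<in> borel_measurable M" "G \<in> borel_measurable borel"
    and S: "\<And>x. x \<in> space M \<Longrightarrow> 0 \<le> S x" and G: "\<And>s. 0 \<le> s \<Longrightarrow> 0 \<le> G s" and "0 \<le> l"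
  shows "(\<integral>x. S x * G (S x) \<partial>M) = l * (\<integral>x. G (S x + 1) \<partial>M)"
proof -
  have "(\<integral>\<^sup>+x. ennreal (S x * G (S x)) \<partial>M) = (\<integral>\<^sup>+x. ennreal (S x) * ennreal (G (S x)) \<partial>M)"
    using S G by (intro nn_integral_cong ennreal_mult) auto
  also have "\<dots> = ennreal l * (\<integral>\<^sup>+x. ennreal (G (S x + 1)) \<partial>M)"
    using assms(1) unfolding poisson_shift_def by (rule bspec[where x = "\<lambda>s. ennreal (G s)"]) simp
  finally show ?thesis
    using S G \<open>0 \<le> l\<close> by (simp add: integral_eq_nn_integral enn2real_mult)
qed

section \<open>Concentration under the quadratic tilt\<close>

text \<open>
  The shift identity makes the middle terms \<open>f s * s * (s / V - m) / V\<close> and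
  \<open>Q * f (s + 1) * ((s + 1) / V - m)\<close> equal in expectation, so this inequality bounds
  the tilted second moment of \<open>s / V - m\<close> by the last, small term.  Put \<open>y = s / V\<close>.  Since
  \<open>y - Q * exp (- 2 * c * y)\<close> vanishes at \<open>m\<close> and increases with slope at least one, its product
  with \<open>y - m\<close> dominates \<open>(y - m)\<^sup>2\<close>; and \<open>f (s + 1)\<close> is \<open>f s * exp (- 2 * c * y)\<close> up to the
  factor \<open>exp (- c / V)\<close>.
\<close>

lemma tilted_pointwise:
  fixes s V Q c m :: real
  defines "f \<equiv> \<lambda>s. exp (- c * s\<^sup>2 / V)"
  assumes s: "0 \<le> s" and V: "0 < V" and Q: "0 < Q" and c: "0 \<le> c" and m: "0 < m"
    and fix_m: "m = Q * exp (- 2 * c * m)"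
  shows "f s * (s / V - m)\<^sup>2 \<le> (f s * s\<^sup>2 / V\<^sup>2 - m * (s * f s) / V)
           - Q * (f (s + 1) * (s + 1) / V - m * f (s + 1)) + Q * (c * m + 1) / V * f s"
proof -
  define y where "y = s / V"
  define e where "e = exp (- 2 * c * y)"
  define u where "u = exp (- c / V)"
  have y: "0 \<le> y" using s V by (simp add: y_def)
  have f: "0 < f s" by (simp add: f_def)
  have f1: "f (s + 1) = f s * (e * u)"
    using V by (simp add: f_def e_def u_def y_def exp_add[symmetric] field_simps power2_eq_square)
  have e1: "0 < e" "e \<le> 1" using y c by (auto simp: e_def)
  have u0: "1 - c / V \<le> u" using exp_ge_add_one_self[of "- c / V"] by (simp add: u_def)
  have u1: "0 < u" "u \<le> 1" using c V by (auto simp: u_def)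
  \<comment> \<open>The antitone function \<open>Q * exp (- 2 * c * y)\<close> of \<open>y\<close> has the value \<open>m\<close> at \<open>m\<close>.\<close>
  have "0 \<le> (m - Q * e) * (y - m)"
  proof (cases "m \<le> y")
    case True
    then have "e \<le> exp (- 2 * c * m)" using c by (simp add: e_def mult_left_mono)
    then have "Q * e \<le> m" using Q by (subst fix_m) simp
    with True show ?thesis by simp
  next
    case False
    then have "exp (- 2 * c * m) \<le> e" using c by (simp add: e_def mult_left_mono)
    then have "m \<le> Q * e" using Q by (subst fix_m) simp
    with False show ?thesis by (simp add: mult_nonpos_nonpos)
  qed
  then have A: "(y - m)\<^sup>2 \<le> y * (y - m) - Q * (e * (y - m))"
    by (simp add: algebra_simps power2_eq_square)
  have "u * (y + 1 / V - m) - (y - m) = (1 - u) * m - (1 - u) * y + u / V"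
    by (simp add: algebra_simps)
  also have "\<dots> \<le> (c / V) * m + 1 / V"
  proof -
    have "(1 - u) * m \<le> (c / V) * m" using u0 m by (intro mult_right_mono) auto
    moreover have "0 \<le> (1 - u) * y" using u1 y by simp
    moreover have "u / V \<le> 1 / V" using u1 V by (simp add: divide_right_mono)
    ultimately show ?thesis by linarith
  qed
  finally have B0: "u * (y + 1 / V - m) - (y - m) \<le> (c * m + 1) / V"
    by (simp add: add_divide_distrib)
  have "e * (u * (y + 1 / V - m) - (y - m)) \<le> e * ((c * m + 1) / V)"
    using B0 e1 by (intro mult_left_mono) auto
  also have "\<dots> \<le> (c * m + 1) / V"
    using e1 c m V by (intro mult_left_le_one_le) auto
  finally have "Q * (e * (u * (y + 1 / V - m) - (y - m))) \<le> Q * ((c * m + 1) / V)"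
    using Q by (intro mult_left_mono) auto
  then have "Q * (e * u * (y + 1 / V - m)) - Q * (e * (y - m)) \<le> Q * ((c * m + 1) / V)"
    by (simp only: right_diff_distrib mult.assoc)
  with A have "(y - m)\<^sup>2 \<le> y * (y - m) - Q * (e * u * (y + 1 / V - m)) + Q * ((c * m + 1) / V)"
    by linarith
  then have "f s * (y - m)\<^sup>2 \<le> f s * (y * (y - m) - Q * (e * u * (y + 1 / V - m)) + Q * ((c * m + 1) / V))"
    using f by (intro mult_left_mono) auto
  also have "\<dots> = (f s * s\<^sup>2 / V\<^sup>2 - m * (s * f s) / V)
           - Q * (f (s + 1) * (s + 1) / V - m * f (s + 1)) + Q * (c * m + 1) / V * f s"
    unfolding f1 y_def using V by (simp add: field_simps power2_eq_square)
  finally show ?thesis by (simp add: y_def)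
qed

text \<open>
  Dividing the shift identity for \<open>f\<close> by \<open>V * E[f(S)]\<close> identifies \<open>Q\<close> times the ratio with the
  mean of \<open>S / V\<close> under the tilted law, and the squared distance of a mean from \<open>m\<close> is at most
  the second moment about \<open>m\<close>.
\<close>

lemma tilted_shift_ratio:
  fixes S :: "'a \<Rightarrow> real" and V Q c m :: real
  defines "f \<equiv> \<lambda>s. exp (- c * s\<^sup>2 / V)"
  assumes M: "prob_space M" and S [measurable]: "S \<in> borel_measurable M"
    and S0: "\<And>x. x \<in> space M \<Longrightarrow> 0 \<le> S x"
    and shift: "poisson_shift M S (V * Q)"
    and V: "0 < V" and Q: "0 < Q" and c: "0 \<le> c" and m: "0 < m"
    and fix_m: "m = Q * exp (- 2 * c * m)"
  shows "(Q * ((\<integral>x. f (S x + 1) \<partial>M) / (\<integral>x. f (S x) \<partial>M)) - m)\<^sup>2 \<le> Q * (c * m + 1) / V"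
    and "0 < (\<integral>x. f (S x) \<partial>M)" "0 < (\<integral>x. f (S x + 1) \<partial>M)"
proof -
  interpret prob_space M by fact
  have f [measurable]: "f \<in> borel_measurable borel" unfolding f_def by measurable
  have f01: "0 < f s" "f s \<le> 1" for s
    using c V by (auto simp: f_def)
  have SG: "(\<integral>\<^sup>+x. ennreal (S x) * G (S x) \<partial>M) = ennreal (V * Q) * (\<integral>\<^sup>+x. G (S x + 1) \<partial>M)"
    if "G \<in> borel_measurable borel" for G
    using shift that by (auto simp: poisson_shift_def)
  have "(\<integral>\<^sup>+x. ennreal (S x) \<partial>M) = ennreal (V * Q)"
    using SG[of "\<lambda>_. 1"] by (simp add: emeasure_space_1)
  then have iS [simp]: "integrable M S"
    using S0 by (intro integrableI_nonneg) auto
  have "(\<integral>\<^sup>+x. ennreal ((S x)\<^sup>2) \<partial>M) = (\<integral>\<^sup>+x. ennreal (S x) * ennreal (S x) \<partial>M)"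
    using S0 by (intro nn_integral_cong) (simp add: power2_eq_square ennreal_mult)
  also have "\<dots> = ennreal (V * Q) * (\<integral>\<^sup>+x. ennreal (S x + 1) \<partial>M)"
    by (rule SG) simp
  also have "(\<integral>\<^sup>+x. ennreal (S x + 1) \<partial>M) < \<infinity>"
    using S0 by (subst nn_integral_eq_integral) auto
  then have "ennreal (V * Q) * (\<integral>\<^sup>+x. ennreal (S x + 1) \<partial>M) < \<infinity>"
    by (simp add: ennreal_mult_less_top)
  finally have iS2 [simp]: "integrable M (\<lambda>x. (S x)\<^sup>2)"
    by (intro integrableI_nonneg) auto
  have iF [simp]: "integrable M (\<lambda>x. f (S x))" "integrable M (\<lambda>x. f (S x + 1))"
    using f01 by (auto intro!: integrable_const_bound[where B = 1] simp: less_imp_le)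
  have i1 [simp]: "integrable M (\<lambda>x. S x * f (S x))"
    by (rule Bochner_Integration.integrable_bound[OF iS])
      (use f01 S0 in \<open>auto simp: abs_mult less_imp_le intro!: mult_right_le_one_le\<close>)
  have i1' [simp]: "integrable M (\<lambda>x. f (S x + 1) * (S x + 1))"
    by (rule Bochner_Integration.integrable_bound[of _ "\<lambda>x. S x + 1"])
      (use f01 S0 in \<open>auto simp: abs_mult less_imp_le intro!: mult_left_le_one_le\<close>)
  have i2 [simp]: "integrable M (\<lambda>x. f (S x) * (S x)\<^sup>2)"
    by (rule Bochner_Integration.integrable_bound[OF iS2])
      (use f01 S0 in \<open>auto simp: abs_mult less_imp_le intro!: mult_left_le_one_le\<close>)
  define A0 where "A0 = (\<integral>x. f (S x) \<partial>M)"
  define A1 where "A1 = (\<integral>x. S x * f (S x) \<partial>M)"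
  define A2 where "A2 = (\<integral>x. f (S x) * (S x)\<^sup>2 \<partial>M)"
  define B0 where "B0 = (\<integral>x. f (S x + 1) \<partial>M)"
  define B1 where "B1 = (\<integral>x. f (S x + 1) * (S x + 1) \<partial>M)"
  have pos: "0 < (\<integral>x. h x \<partial>M)" if "\<And>x. 0 < h x" "integrable M h" for h :: "'a \<Rightarrow> real"
    using integral_less_AE_space[of "\<lambda>_. 0" h] that by (simp add: emeasure_space_1)
  show A0: "0 < (\<integral>x. f (S x) \<partial>M)" and "0 < (\<integral>x. f (S x + 1) \<partial>M)"
    by (auto intro!: pos f01)
  then have A0: "0 < A0" by (simp add: A0_def)
  have A1: "A1 = V * Q * B0"
    unfolding A1_def B0_def using V Q S0 f01
    by (intro poisson_shift_integral[OF shift]) (auto simp: less_imp_le)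
  have A2: "A2 = V * Q * B1"
  proof -
    have "A2 = (\<integral>x. S x * (f (S x) * S x) \<partial>M)"
      unfolding A2_def by (simp add: power2_eq_square ac_simps)
    also have "\<dots> = V * Q * B1"
      unfolding B1_def using V Q S0 f01
      by (intro poisson_shift_integral[OF shift]) (auto simp: less_imp_le)
    finally show ?thesis .
  qed
  have expand: "(\<integral>x. f (S x) * (S x / V - t)\<^sup>2 \<partial>M) = A2 / V\<^sup>2 - 2 * t * A1 / V + t\<^sup>2 * A0" for t
  proof -
    have "(\<integral>x. f (S x) * (S x / V - t)\<^sup>2 \<partial>M)
        = (\<integral>x. f (S x) * (S x)\<^sup>2 / V\<^sup>2 - 2 * t / V * (S x * f (S x)) + t\<^sup>2 * f (S x) \<partial>M)"
      using V by (intro Bochner_Integration.integral_cong refl) (simp add: field_simps power2_eq_square)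
    then show ?thesis by (simp add: A0_def A1_def A2_def)
  qed
  have int_sq: "integrable M (\<lambda>x. f (S x) * (S x / V - t)\<^sup>2)" for t
  proof -
    have "integrable M (\<lambda>x. f (S x) * (S x)\<^sup>2 / V\<^sup>2 - 2 * t / V * (S x * f (S x)) + t\<^sup>2 * f (S x))"
      by simp
    also have "(\<lambda>x. f (S x) * (S x)\<^sup>2 / V\<^sup>2 - 2 * t / V * (S x * f (S x)) + t\<^sup>2 * f (S x))
      = (\<lambda>x. f (S x) * (S x / V - t)\<^sup>2)"
      using V by (intro ext) (simp add: field_simps power2_eq_square)
    finally show ?thesis .
  qed
  have "(\<integral>x. f (S x) * (S x / V - m)\<^sup>2 \<partial>M)
      \<le> (\<integral>x. (f (S x) * (S x)\<^sup>2 / V\<^sup>2 - m * (S x * f (S x)) / V)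
           - Q * (f (S x + 1) * (S x + 1) / V - m * f (S x + 1)) + Q * (c * m + 1) / V * f (S x) \<partial>M)"
  proof (rule integral_mono[OF int_sq])
    show "f (S x) * (S x / V - m)\<^sup>2
      \<le> (f (S x) * (S x)\<^sup>2 / V\<^sup>2 - m * (S x * f (S x)) / V)
           - Q * (f (S x + 1) * (S x + 1) / V - m * f (S x + 1)) + Q * (c * m + 1) / V * f (S x)"
      if "x \<in> space M" for x
      using tilted_pointwise[OF S0[OF that] V Q c m fix_m] by (simp only: f_def)
  qed simp
  also have "\<dots> = (A2 / V\<^sup>2 - m * A1 / V) - Q * (B1 / V - m * B0) + Q * (c * m + 1) / V * A0"
    by (simp add: A0_def A1_def A2_def B0_def B1_def)
  also have "\<dots> = Q * (c * m + 1) / V * A0"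
    unfolding A1 A2 using V by (simp add: field_simps power2_eq_square)
  finally have upper: "A2 / V\<^sup>2 - 2 * m * A1 / V + m\<^sup>2 * A0 \<le> Q * (c * m + 1) / V * A0"
    unfolding expand .
  \<comment> \<open>\<open>u\<close> is the tilted mean of \<open>S / V\<close>; its variance is nonnegative.\<close>
  define u where "u = A1 / (V * A0)"
  have "0 \<le> A2 / V\<^sup>2 - 2 * u * A1 / V + u\<^sup>2 * A0"
    unfolding expand[symmetric] by (intro Bochner_Integration.integral_nonneg) (use f01 in \<open>auto simp: less_imp_le\<close>)
  then have "A0 * (u - m)\<^sup>2 \<le> A2 / V\<^sup>2 - 2 * m * A1 / V + m\<^sup>2 * A0"
    using A0 V by (simp add: u_def field_simps power2_eq_square)
  with upper have "A0 * (u - m)\<^sup>2 \<le> A0 * (Q * (c * m + 1) / V)"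
    by (simp add: mult.commute)
  then have "(u - m)\<^sup>2 \<le> Q * (c * m + 1) / V"
    using A0 by (rule mult_left_le_imp_le)
  moreover have "u = Q * (B0 / A0)"
    unfolding u_def A1 using V by simp
  ultimately show "(Q * ((\<integral>x. f (S x + 1) \<partial>M) / (\<integral>x. f (S x) \<partial>M)) - m)\<^sup>2 \<le> Q * (c * m + 1) / V"
    by (simp add: A0_def B0_def)
qed

section \<open>The reference measure on summable sequences\<close>

definition rescale :: "nat \<Rightarrow> nat \<Rightarrow> (nat \<Rightarrow> nat) \<Rightarrow> nat \<Rightarrow> real" where
  "rescale d N n = (\<lambda>k\<in>{1..}. real (n k) / vol d N)"

definition total :: "(nat \<Rightarrow> real) \<Rightarrow> real" where
  "total x = (\<Sum>k. x (Suc k))"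

definition q_total :: "nat \<Rightarrow> real \<Rightarrow> real \<Rightarrow> real" where
  "q_total d \<beta> \<alpha> = (\<Sum>k. q d \<beta> \<alpha> (Suc k))"

definition tail_weight :: "nat \<Rightarrow> real \<Rightarrow> real \<Rightarrow> nat \<Rightarrow> ennreal" where
  "tail_weight d \<beta> \<alpha> K = (\<Sum>j. ennreal (real (j + Suc K) * q d \<beta> \<alpha> (j + Suc K)))"

lemma measurable_seq_component [measurable]: "1 \<le> k \<Longrightarrow> (\<lambda>x. x k) \<in> borel_measurable seq_space"
  unfolding seq_space_def by (intro measurable_component_singleton) auto

lemma measurable_total [measurable]: "total \<in> borel_measurable seq_space"
  unfolding total_def[abs_def] by (intro borel_measurable_suminf measurable_seq_component) simp

lemma measurable_rescale [measurable]: "rescale d N \<in> measurable (poisson_counts d N \<beta> \<alpha>) seq_space"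
  unfolding rescale_def[abs_def] seq_space_def poisson_counts_def
  by (intro measurable_restrict measurable_compose[OF measurable_component_singleton]) auto

lemma ell1_nonneg: "x \<in> ell1 \<Longrightarrow> 0 \<le> x (Suc k)"
  and ell1_summable: "x \<in> ell1 \<Longrightarrow> summable (\<lambda>k. x (Suc k))"
  by (auto simp: ell1_def)

lemma ell1_total_nonneg: "x \<in> ell1 \<Longrightarrow> 0 \<le> total x"
  unfolding total_def by (intro suminf_nonneg ell1_summable ell1_nonneg)

text \<open>
  With \<open>t = 1 / V\<close> this adds one cycle of length \<open>k\<close>, with \<open>t = - 1 / V\<close> it removes one.
\<close>

lemma ell1_upd:
  assumes x: "x \<in> ell1" and k: "1 \<le> k" and t: "0 \<le> x k + t"
  shows "x(k := x k + t) \<in> ell1" and "total (x(k := x k + t)) = total x + t"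
proof -
  obtain i where i: "k = Suc i" using k by (cases k) auto
  have eq: "(\<lambda>j. (x(k := x k + t)) (Suc j)) = (\<lambda>j. x (Suc j) + (if j = i then t else 0))"
    by (auto simp: i)
  have s: "(\<lambda>j. x (Suc j)) sums total x"
    unfolding total_def by (intro summable_sums ell1_summable x)
  have "(\<lambda>j. (x(k := x k + t)) (Suc j)) sums (total x + t)"
    unfolding eq by (intro sums_add s) (use sums_single[of i "\<lambda>_. t"] in simp)
  note * = sums_summable[OF this] sums_unique[OF this]
  show "total (x(k := x k + t)) = total x + t"
    using * by (simp add: total_def)
  show "x(k := x k + t) \<in> ell1"
    using * x k t by (auto simp: ell1_def seq_space_def space_PiM PiE_def extensional_def)
qed

lemma space_nu: "space (nu d N \<beta> \<alpha>) = ell1"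
  using sets.sets_into_space[OF ell1_sets] by (auto simp: nu_def space_restrict_space)

lemma measurable_nu: "f \<in> borel_measurable seq_space \<Longrightarrow> f \<in> borel_measurable (nu d N \<beta> \<alpha>)"
  unfolding nu_def by (intro measurable_restrict_space1) simp

lemma nn_integral_nu:
  assumes [measurable]: "G \<in> borel_measurable seq_space"
  shows "(\<integral>\<^sup>+x. G x \<partial>nu d N \<beta> \<alpha>)
    = (\<integral>\<^sup>+n. G (rescale d N n) * indicator ell1 (rescale d N n) \<partial>poisson_counts d N \<beta> \<alpha>)"
proof -
  note [measurable] = ell1_sets
  have "(\<integral>\<^sup>+x. G x \<partial>nu d N \<beta> \<alpha>)
      = (\<integral>\<^sup>+x. G x * indicator ell1 x \<partial>distr (poisson_counts d N \<beta> \<alpha>) seq_space (rescale d N))"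
    unfolding nu_def rescale_def[symmetric, abs_def] using ell1_sets
    by (intro nn_integral_restrict_space) auto
  also have "\<dots> = (\<integral>\<^sup>+n. G (rescale d N n) * indicator ell1 (rescale d N n) \<partial>poisson_counts d N \<beta> \<alpha>)"
    by (rule nn_integral_distr) auto
  finally show ?thesis .
qed

text \<open>
  The shift identity for the \<open>k\<close>-th count is applied to the functional \<open>F\<close> of the counts that
  cuts off outside \<open>ell1\<close>; one more cycle preserves membership in \<open>ell1\<close> in both
  directions and raises the total by \<open>1 / V\<close>.
\<close>

lemma nn_integral_nu_shift:
  fixes G :: "real \<Rightarrow> ennreal"
  assumes "0 < \<beta>" "1 \<le> N" "1 \<le> k" and [measurable]: "G \<in> borel_measurable borel"
  shows "(\<integral>\<^sup>+x. ennreal (vol d N * x k) * G (vol d N * total x) \<partial>nu d N \<beta> \<alpha>)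
    = ennreal (vol d N * q d \<beta> \<alpha> k) * (\<integral>\<^sup>+x. G (vol d N * total x + 1) \<partial>nu d N \<beta> \<alpha>)"
proof -
  note [measurable] = ell1_sets
  let ?V = "vol d N" and ?P = "poisson_counts d N \<beta> \<alpha>" and ?X = "rescale d N"
  have V: "0 < ?V" using assms by (intro vol_pos)
  define F where "F n = G (?V * total (?X n)) * indicator ell1 (?X n)" for n
  have upd: "?X (n(k := Suc (n k))) = (?X n)(k := ?X n k + 1 / ?V)" for n
    using \<open>1 \<le> k\<close> by (auto simp: rescale_def fun_eq_iff add_divide_distrib)
  have X0: "0 \<le> ?X n k" for n
    using V \<open>1 \<le> k\<close> by (auto simp: rescale_def)
  \<comment> \<open>Outside \<open>ell1\<close> the function \<open>total\<close> takes default values; the cutoff keeps them out.\<close>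
  have F_upd: "F (n(k := Suc (n k))) = G (?V * total (?X n) + 1) * indicator ell1 (?X n)" for n
  proof (cases "?X n \<in> ell1")
    case True
    then show ?thesis
      using ell1_upd[OF True \<open>1 \<le> k\<close>, of "1 / ?V"] V X0[of n]
      by (simp add: F_def upd distrib_left)
  next
    case False
    have "?X (n(k := Suc (n k))) \<notin> ell1"
    proof
      assume "?X (n(k := Suc (n k))) \<in> ell1"
      from ell1_upd(1)[OF this \<open>1 \<le> k\<close>, of "- (1 / ?V)"] show False
        using False X0[of n] by (simp add: upd)
    qed
    with False show ?thesis by (simp add: F_def)
  qed
  have "F \<in> borel_measurable ?P"
    unfolding F_def[abs_def] by measurable
  then have "(\<integral>\<^sup>+n. of_nat (n k) * F n \<partial>?P)
      = ennreal (?V * q d \<beta> \<alpha> k) * (\<integral>\<^sup>+n. F (n(k := Suc (n k))) \<partial>?P)"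
    unfolding poisson_counts_def using assms V
    by (intro nn_integral_PiM_poisson_shift mult_pos_pos q_pos) auto
  moreover have "of_nat (n k) * F n
      = ennreal (?V * ?X n k) * G (?V * total (?X n)) * indicator ell1 (?X n)" for n
    using V \<open>1 \<le> k\<close> by (simp add: F_def rescale_def ennreal_of_nat_eq_real_of_nat mult.assoc)
  ultimately show ?thesis
    using \<open>1 \<le> k\<close> by (simp add: nn_integral_nu F_upd)
qed

lemma q_total_sums:
  assumes "1 \<le> d" "0 < \<beta>" "\<alpha> \<le> 0"
  shows "0 < q_total d \<beta> \<alpha>"
    and "(\<Sum>k. ennreal (q d \<beta> \<alpha> (Suc k))) = ennreal (q_total d \<beta> \<alpha>)"
proof -
  note s = summable_q[OF assms]
  have p: "0 < q d \<beta> \<alpha> (Suc k)" for k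
    using assms by (intro q_pos) auto
  show "0 < q_total d \<beta> \<alpha>"
    unfolding q_total_def by (intro suminf_pos s p)
  show "(\<Sum>k. ennreal (q d \<beta> \<alpha> (Suc k))) = ennreal (q_total d \<beta> \<alpha>)"
    unfolding q_total_def using p by (intro suminf_ennreal2 s) (auto simp: less_imp_le)
qed

lemma poisson_shift_nu:
  assumes "1 \<le> d" "0 < \<beta>" "\<alpha> \<le> 0" "1 \<le> N"
  shows "poisson_shift (nu d N \<beta> \<alpha>) (\<lambda>x. vol d N * total x) (vol d N * q_total d \<beta> \<alpha>)"
  unfolding poisson_shift_def
proof
  fix G :: "real \<Rightarrow> ennreal" assume G [measurable]: "G \<in> borel_measurable borel"
  let ?V = "vol d N" and ?nu = "nu d N \<beta> \<alpha>"
  have V: "0 < ?V" using assms by (intro vol_pos)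
  have q0: "0 \<le> q d \<beta> \<alpha> (Suc k)" for k
    using assms by (intro less_imp_le[OF q_pos]) auto
  have "(\<integral>\<^sup>+x. ennreal (?V * total x) * G (?V * total x) \<partial>?nu)
      = (\<integral>\<^sup>+x. (\<Sum>k. ennreal (?V * x (Suc k)) * G (?V * total x)) \<partial>?nu)"
  proof (rule nn_integral_cong)
    fix x assume "x \<in> space ?nu"
    then have x: "x \<in> ell1" by (simp add: space_nu)
    have "(\<Sum>k. ennreal (?V * x (Suc k))) = ennreal (\<Sum>k. ?V * x (Suc k))"
      using V x by (intro suminf_ennreal2 summable_mult ell1_summable) (auto simp: ell1_nonneg)
    also have "(\<Sum>k. ?V * x (Suc k)) = ?V * total x"
      unfolding total_def by (intro suminf_mult ell1_summable x)
    finally show "ennreal (?V * total x) * G (?V * total x)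
        = (\<Sum>k. ennreal (?V * x (Suc k)) * G (?V * total x))"
      by simp
  qed
  also have "\<dots> = (\<Sum>k. \<integral>\<^sup>+x. ennreal (?V * x (Suc k)) * G (?V * total x) \<partial>?nu)"
    by (intro nn_integral_suminf measurable_nu) measurable
  also have "\<dots> = (\<Sum>k. ennreal ?V * ennreal (q d \<beta> \<alpha> (Suc k)) * (\<integral>\<^sup>+x. G (?V * total x + 1) \<partial>?nu))"
    using assms V q0 by (simp add: nn_integral_nu_shift ennreal_mult)
  also have "\<dots> = ennreal (?V * q_total d \<beta> \<alpha>) * (\<integral>\<^sup>+x. G (?V * total x + 1) \<partial>?nu)"
    using q_total_sums[OF assms(1-3)] V by (simp add: ennreal_mult)
  finally show "(\<integral>\<^sup>+x. ennreal (?V * total x) * G (?V * total x) \<partial>?nu)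
      = ennreal (?V * q_total d \<beta> \<alpha>) * (\<integral>\<^sup>+x. G (?V * total x + 1) \<partial>?nu)" .
qed

section \<open>Expected tail in finite volume\<close>

lemma Dens_tail: "Dens x - Dens_upto K x = (\<Sum>j. ennreal (real (j + Suc K) * x (j + Suc K)))"
proof -
  have "{..<Suc K} = insert 0 {1..K}" by auto
  then have "(\<Sum>k<Suc K. ennreal (real k * x k)) = Dens_upto K x"
    by (simp add: Dens_upto_def)
  then have "Dens x = (\<Sum>j. ennreal (real (j + Suc K) * x (j + Suc K))) + Dens_upto K x"
    unfolding Dens_def by (subst suminf_offset[where i = "Suc K"]) auto
  moreover have "Dens_upto K x \<noteq> top"
    by (simp add: Dens_upto_def)
  ultimately show ?thesis by simp
qed

text \<open>
  Each length \<open>k > K\<close> contributes \<open>k / V\<close> times the mean of \<open>V * x k\<close> against the density, and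
  the shift identity turns this into \<open>k * q k\<close> times a factor that is the same for all \<open>k\<close>.
\<close>

lemma tail_mean_nu_CMF:
  fixes d N :: nat and \<alpha> \<beta> a :: real
  defines "V \<equiv> vol d N" and "f \<equiv> (\<lambda>s. exp (- (\<beta> * a / 2) * s\<^sup>2 / vol d N))"
  defines "Z \<equiv> (\<integral>x. f (V * total x) \<partial>nu d N \<beta> \<alpha>)"
    and "Z1 \<equiv> (\<integral>x. f (V * total x + 1) \<partial>nu d N \<beta> \<alpha>)"
  assumes "1 \<le> d" "0 < \<beta>" "\<alpha> \<le> 0" "1 \<le> N" "0 \<le> a" and Z: "0 < Z"
  shows "tail_mean (nu_CMF d N \<beta> \<alpha> a) K = tail_weight d \<beta> \<alpha> K * ennreal (Z1 / Z)"
proof -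
  let ?nu = "nu d N \<beta> \<alpha>"
  interpret prob_space ?nu using assms by (intro prob_space_nu)
  have V: "0 < V" using assms by (simp add: vol_pos)
  have f [measurable]: "f \<in> borel_measurable borel" unfolding f_def by measurable
  have f01: "0 \<le> f s" "f s \<le> 1" for s
    using assms V by (auto simp: f_def)
  have weight: "exp (- \<beta> * vol d N * H_CMF a x) = f (V * total x)" for x
    using V by (simp add: H_CMF_def f_def V_def total_def power_mult_distrib power2_eq_square)
  define g where "g s = ennreal (f s / Z)" for s
  have g [measurable]: "g \<in> borel_measurable borel" unfolding g_def[abs_def] by measurable
  have CMF: "nu_CMF d N \<beta> \<alpha> a = density ?nu (\<lambda>x. g (V * total x))"
    unfolding nu_CMF_def Z_CMF_def weight g_def Z_def ..
  have m [measurable]: "(\<lambda>x. x (j + Suc K)) \<in> borel_measurable ?nu" for j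
    by (intro measurable_nu) simp
  have mt [measurable]: "total \<in> borel_measurable ?nu"
    by (intro measurable_nu measurable_total)
  have scale: "ennreal (real k * x k) = ennreal (real k / V) * ennreal (V * x k)" for k and x :: "nat \<Rightarrow> real"
    using V by (subst ennreal_mult'[symmetric]) auto
  have "tail_mean (nu_CMF d N \<beta> \<alpha> a) K
      = (\<integral>\<^sup>+x. g (V * total x) * (\<Sum>j. ennreal (real (j + Suc K) * x (j + Suc K))) \<partial>?nu)"
    unfolding tail_mean_def CMF Dens_tail by (intro nn_integral_density) measurable
  also have "\<dots> = (\<integral>\<^sup>+x. (\<Sum>j. ennreal (real (j + Suc K) / V) * (ennreal (V * x (j + Suc K)) * g (V * total x))) \<partial>?nu)"
    unfolding scale ennreal_suminf_cmult[symmetric] by (simp only: ac_simps)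
  also have "\<dots> = (\<Sum>j. \<integral>\<^sup>+x. ennreal (real (j + Suc K) / V) * (ennreal (V * x (j + Suc K)) * g (V * total x)) \<partial>?nu)"
    by (intro nn_integral_suminf) measurable
  also have "\<dots> = (\<Sum>j. ennreal (real (j + Suc K) / V) * (\<integral>\<^sup>+x. ennreal (V * x (j + Suc K)) * g (V * total x) \<partial>?nu))"
    by (intro suminf_cong nn_integral_cmult) measurable
  also have "\<dots> = (\<Sum>j. ennreal (real (j + Suc K) / V) * (ennreal (V * q d \<beta> \<alpha> (j + Suc K)) * (\<integral>\<^sup>+x. g (V * total x + 1) \<partial>?nu)))"
    unfolding V_def using assms by (subst nn_integral_nu_shift) auto
  also have "\<dots> = tail_weight d \<beta> \<alpha> K * (\<integral>\<^sup>+x. g (V * total x + 1) \<partial>?nu)"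
    unfolding tail_weight_def scale[of _ "q d \<beta> \<alpha>"] ennreal_suminf_multc[symmetric] by (simp only: mult.assoc)
  also have "(\<integral>\<^sup>+x. g (V * total x + 1) \<partial>?nu) = ennreal (Z1 / Z)"
  proof -
    have "integrable ?nu (\<lambda>x. f (V * total x + 1))"
      using f01 by (intro integrable_const_bound[where B = 1]) auto
    then have "(\<integral>\<^sup>+x. g (V * total x + 1) \<partial>?nu) = ennreal (\<integral>x. f (V * total x + 1) / Z \<partial>?nu)"
      unfolding g_def using Z f01 by (intro nn_integral_eq_integral) auto
    then show ?thesis by (simp add: Z1_def)
  qed
  finally show ?thesis .
qed

section \<open>Infinite volume\<close>

lemma mean_field_fixpoint:
  fixes Q c :: real
  assumes "0 < Q" "0 \<le> c"
  obtains m where "0 < m" "m = Q * exp (- 2 * c * m)"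
proof -
  let ?h = "\<lambda>y. y - Q * exp (- 2 * c * y)"
  have "\<exists>y\<ge>0. y \<le> Q \<and> ?h y = 0"
    using assms by (intro IVT') (auto intro!: continuous_intros)
  then obtain m where "?h m = 0" by auto
  then have "m = Q * exp (- 2 * c * m)" by simp
  moreover from this have "0 < m" using assms by (metis exp_gt_zero mult_pos_pos)
  ultimately show ?thesis using that by blast
qed

lemma vol_at_top:
  assumes "1 \<le> d" shows "filterlim (\<lambda>N. vol d N) at_top sequentially"
  unfolding vol_def using assms
  by (intro filterlim_pow_at_top filterlim_tendsto_pos_mult_at_top[OF tendsto_const] filterlim_real_sequentially) auto

text \<open>
  The ratio \<open>r N\<close> differs from \<open>m / Q\<close> by at most a constant over \<open>sqrt V\<close>.  Positivity of this
  limit matters: it keeps an infinite sum of \<open>k * q k\<close> infinite.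
\<close>

lemma tail_mean_nu_CMF_limit:
  assumes "1 \<le> d" "0 < \<beta>" "\<alpha> \<le> 0" "0 \<le> a"
  shows "\<exists>R>0. \<forall>K. (\<lambda>N. tail_mean (nu_CMF d N \<beta> \<alpha> a) K) \<longlonglongrightarrow> tail_weight d \<beta> \<alpha> K * ennreal R"
proof -
  define Q where "Q = q_total d \<beta> \<alpha>"
  define c where "c = \<beta> * a / 2"
  have Q: "0 < Q" unfolding Q_def using assms by (intro q_total_sums)
  have c: "0 \<le> c" using assms by (simp add: c_def)
  obtain m where m: "0 < m" "m = Q * exp (- 2 * c * m)"
    using mean_field_fixpoint[OF Q c] .
  define Z where "Z N t = (\<integral>x. exp (- c * (vol d N * total x + t)\<^sup>2 / vol d N) \<partial>nu d N \<beta> \<alpha>)" for N t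
  define r where "r N = Z N 1 / Z N 0" for N
  have bound: "(Q * r N - m)\<^sup>2 \<le> Q * (c * m + 1) / vol d N" "0 < Z N 0" "0 < Z N 1" if "1 \<le> N" for N
  proof -
    have V: "0 < vol d N" using that by (rule vol_pos)
    note * = tilted_shift_ratio[OF prob_space_nu[OF assms(1-3) that] _ _
        poisson_shift_nu[OF assms(1-3) that, folded Q_def] V Q c m]
    have meas: "(\<lambda>x. vol d N * total x) \<in> borel_measurable (nu d N \<beta> \<alpha>)"
      by (intro measurable_nu) measurable
    have nonneg: "0 \<le> vol d N * total x" if "x \<in> space (nu d N \<beta> \<alpha>)" for x
      using that V by (simp add: space_nu ell1_total_nonneg)
    show "(Q * r N - m)\<^sup>2 \<le> Q * (c * m + 1) / vol d N" "0 < Z N 0" "0 < Z N 1"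
      unfolding r_def Z_def using *[OF meas nonneg] by simp_all
  qed
  have "(\<lambda>N. Q * (c * m + 1) / vol d N) \<longlonglongrightarrow> 0"
    using assms by (intro real_tendsto_divide_at_top[OF tendsto_const] vol_at_top)
  then have "(\<lambda>N. (Q * r N - m)\<^sup>2) \<longlonglongrightarrow> 0"
    by (rule tendsto_sandwich[OF _ _ tendsto_const, rotated 2])
      (auto intro!: eventually_sequentiallyI[of 1] bound(1))
  then have "(\<lambda>N. Q * r N - m) \<longlonglongrightarrow> 0"
    using tendsto_real_sqrt[of "\<lambda>N. (Q * r N - m)\<^sup>2" 0 sequentially]
    by (simp add: tendsto_rabs_zero_iff)
  then have "(\<lambda>N. (Q * r N - m) / Q + m / Q) \<longlonglongrightarrow> 0 / Q + m / Q"
    using Q by (intro tendsto_intros) auto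
  then have r: "r \<longlonglongrightarrow> m / Q"
    using Q by (simp add: field_simps)
  have R: "0 < m / Q" using m Q by simp
  show ?thesis
  proof (intro exI[of _ "m / Q"] conjI allI R)
    fix K
    have "(\<lambda>N. tail_weight d \<beta> \<alpha> K * ennreal (r N)) \<longlonglongrightarrow> tail_weight d \<beta> \<alpha> K * ennreal (m / Q)"
      using R by (intro tendsto_mult_ennreal tendsto_const tendsto_ennrealI r) (auto simp: ennreal_eq_0_iff)
    moreover have "\<forall>\<^sub>F N in sequentially. tail_weight d \<beta> \<alpha> K * ennreal (r N) = tail_mean (nu_CMF d N \<beta> \<alpha> a) K"
    proof (rule eventually_sequentiallyI[of 1])
      fix N :: nat assume "1 \<le> N"
      with tail_mean_nu_CMF[of d \<beta> \<alpha> N a K] bound(2)[of N] assms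
      show "tail_weight d \<beta> \<alpha> K * ennreal (r N) = tail_mean (nu_CMF d N \<beta> \<alpha> a) K"
        by (simp add: r_def Z_def c_def)
    qed
    ultimately show "(\<lambda>N. tail_mean (nu_CMF d N \<beta> \<alpha> a) K) \<longlonglongrightarrow> tail_weight d \<beta> \<alpha> K * ennreal (m / Q)"
      by (rule Lim_transform_eventually)
  qed
qed

lemma nu_CMF_no_interaction:
  assumes "1 \<le> d" "0 < \<beta>" "\<alpha> \<le> 0" "1 \<le> N"
  shows "nu_CMF d N \<beta> \<alpha> 0 = nu d N \<beta> \<alpha>"
proof -
  interpret prob_space "nu d N \<beta> \<alpha>" using assms by (rule prob_space_nu)
  have "Z_CMF d N \<beta> \<alpha> 0 = 1"
    by (simp add: Z_CMF_def H_CMF_def prob_space)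
  then show ?thesis
    by (simp add: nu_CMF_def H_CMF_def density_1)
qed

section \<open>Convergence of the sum over cycle lengths\<close>

lemma tail_weight_tendsto:
  assumes "0 < \<beta>"
  shows "tail_weight d \<beta> \<alpha> \<longlonglongrightarrow> (if summable (\<lambda>k. real k * q d \<beta> \<alpha> k) then 0 else \<infinity>)"
proof (cases "summable (\<lambda>k. real k * q d \<beta> \<alpha> k)")
  case True
  have nonneg: "0 \<le> real (j + Suc K) * q d \<beta> \<alpha> (j + Suc K)" for j K
    using assms by (intro mult_nonneg_nonneg less_imp_le[OF q_pos]) auto
  have eq: "tail_weight d \<beta> \<alpha> K = ennreal (\<Sum>j. real (j + Suc K) * q d \<beta> \<alpha> (j + Suc K))" for K
    unfolding tail_weight_def using summable_ignore_initial_segment[OF True, of "Suc K"] nonneg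
    by (intro suminf_ennreal2) auto
  have "(\<lambda>K. \<Sum>j. real (j + Suc K) * q d \<beta> \<alpha> (j + Suc K)) \<longlonglongrightarrow> 0"
    using LIMSEQ_Suc[OF suminf_exist_split2[OF True]] .
  from tendsto_ennrealI[OF this] show ?thesis
    using True by (simp add: eq[abs_def])
next
  case False
  have "tail_weight d \<beta> \<alpha> K = \<infinity>" for K
  proof (rule ccontr)
    assume "tail_weight d \<beta> \<alpha> K \<noteq> \<infinity>"
    then have "summable (\<lambda>j. real (j + Suc K) * q d \<beta> \<alpha> (j + Suc K))"
      unfolding tail_weight_def using assms
      by (intro summable_suminf_not_top mult_nonneg_nonneg less_imp_le[OF q_pos]) auto
    with False show False
      by (subst (asm) summable_iff_shift[where f = "\<lambda>k. real k * q d \<beta> \<alpha> k"]) simp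
  qed
  then have "tail_weight d \<beta> \<alpha> = (\<lambda>_. \<infinity>)" by auto
  then show ?thesis using False by simp
qed

lemma real_mult_q:
  assumes "0 < k"
  shows "real k * q d \<beta> \<alpha> k = exp (\<beta> * real k * \<alpha>) * real k powr (- (real d / 2)) / (4 * pi * \<beta>) powr (real d / 2)"
proof -
  have "real k powr (1 + real d / 2) = real k * real k powr (real d / 2)"
    using assms by (subst powr_add) simp
  then show ?thesis
    using assms by (simp add: q_def powr_minus divide_simps)
qed

lemma summable_real_mult_q_neg:
  assumes "0 < \<beta>" "\<alpha> < 0"
  shows "summable (\<lambda>k. real k * q d \<beta> \<alpha> k)"
proof (rule summable_comparison_test')
  let ?c = "(4 * pi * \<beta>) powr (real d / 2)"
  have "0 < ?c" using assms by simp
  show "summable (\<lambda>k. exp (\<beta> * \<alpha>) ^ k / ?c)"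
    using assms by (intro summable_divide summable_geometric) (simp add: mult_pos_neg)
  fix k :: nat assume k: "1 \<le> k"
  have "real k powr (- (real d / 2)) \<le> real k powr 0"
    using k by (intro powr_mono) auto
  then have "exp (\<beta> * real k * \<alpha>) * real k powr (- (real d / 2)) \<le> exp (\<beta> * real k * \<alpha>) * 1"
    using k by (intro mult_left_mono) auto
  also have "\<dots> = exp (\<beta> * \<alpha>) ^ k"
    by (simp add: exp_of_nat_mult[symmetric] ac_simps)
  finally show "norm (real k * q d \<beta> \<alpha> k) \<le> exp (\<beta> * \<alpha>) ^ k / ?c"
    using k \<open>0 < ?c\<close> by (subst real_mult_q) (auto simp: divide_right_mono)
qed

lemma summable_real_mult_q_zero:
  assumes "0 < \<beta>"
  shows "summable (\<lambda>k. real k * q d \<beta> 0 k) \<longleftrightarrow> 2 < d"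
proof -
  let ?c = "(4 * pi * \<beta>) powr (real d / 2)"
  have "summable (\<lambda>k. real k * q d \<beta> 0 k) \<longleftrightarrow> summable (\<lambda>k. real k powr (- (real d / 2)) / ?c)"
    by (intro summable_cong eventually_sequentiallyI[of 1]) (simp add: real_mult_q)
  also have "\<dots> \<longleftrightarrow> summable (\<lambda>k. real k powr (- (real d / 2)))"
    using assms by (subst summable_divide_iff) auto
  also have "\<dots> \<longleftrightarrow> 2 < d"
    by (subst summable_real_powr_iff) auto
  finally show ?thesis .
qed

section \<open>The iterated limits\<close>

lemma Delta_CMF_eq:
  assumes "1 \<le> d" "0 < \<beta>" "\<alpha> \<le> 0" "0 \<le> a"
  shows "Delta_CMF_exists d \<beta> \<alpha> a"
    and "Delta_CMF d \<beta> \<alpha> a = (if summable (\<lambda>k. real k * q d \<beta> \<alpha> k) then 0 else \<infinity>)" (is "_ = ?L")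
proof -
  obtain R where R: "0 < R" and
    lim: "\<And>K. (\<lambda>N. tail_mean (nu_CMF d N \<beta> \<alpha> a) K) \<longlonglongrightarrow> tail_weight d \<beta> \<alpha> K * ennreal R"
    using tail_mean_nu_CMF_limit[OF assms] by blast
  have "(\<lambda>K. tail_weight d \<beta> \<alpha> K * ennreal R) \<longlonglongrightarrow> ?L * ennreal R"
    using R by (intro tendsto_mult_ennreal tendsto_const tail_weight_tendsto assms) (auto simp: ennreal_eq_0_iff)
  also have "?L * ennreal R = ?L"
    using R by (simp add: ennreal_top_mult ennreal_eq_0_iff)
  finally have outer: "(\<lambda>K. tail_weight d \<beta> \<alpha> K * ennreal R) \<longlonglongrightarrow> ?L" .
  show "Delta_CMF_exists d \<beta> \<alpha> a"
    unfolding Delta_CMF_exists_def iterated_lim_exists_def limI[OF lim]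
    using lim outer by (auto simp: convergent_def)
  show "Delta_CMF d \<beta> \<alpha> a = ?L"
    unfolding Delta_CMF_def iterated_lim_def limI[OF lim] by (rule limI[OF outer])
qed

text \<open>
  The normalisation of the cycle-mean-field measure with \<open>a = 0\<close> needs a probability measure, which
  is available for \<open>N \<ge> 1\<close>; so the expected tails agree eventually.
\<close>

lemma Delta_eq:
  assumes "1 \<le> d" "0 < \<beta>" "\<alpha> \<le> 0"
  shows "Delta_exists d \<beta> \<alpha>" and "Delta d \<beta> \<alpha> = Delta_CMF d \<beta> \<alpha> 0"
proof -
  have ev: "\<forall>\<^sub>F N in sequentially. tail_mean (nu_CMF d N \<beta> \<alpha> 0) K = tail_mean (nu d N \<beta> \<alpha>) K" for K
    using assms by (intro eventually_sequentiallyI[of 1]) (simp add: nu_CMF_no_interaction)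
  obtain R where
    lim0: "\<And>K. (\<lambda>N. tail_mean (nu_CMF d N \<beta> \<alpha> 0) K) \<longlonglongrightarrow> tail_weight d \<beta> \<alpha> K * ennreal R"
    using tail_mean_nu_CMF_limit[OF assms order_refl] by blast
  have lim: "(\<lambda>N. tail_mean (nu d N \<beta> \<alpha>) K) \<longlonglongrightarrow> tail_weight d \<beta> \<alpha> K * ennreal R" for K
    using lim0 ev by (rule Lim_transform_eventually)
  show "Delta_exists d \<beta> \<alpha>"
    using Delta_CMF_eq(1)[OF assms order_refl] lim
    by (auto simp: Delta_exists_def Delta_CMF_exists_def iterated_lim_exists_def limI[OF lim] limI[OF lim0] convergent_def)
  show "Delta d \<beta> \<alpha> = Delta_CMF d \<beta> \<alpha> 0"
    by (simp add: Delta_def Delta_CMF_def iterated_lim_def limI[OF lim] limI[OF lim0])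
qed

theorem theorem3p16:
  fixes d :: nat and \<beta> a :: real
  assumes "1 \<le> d" and "0 < \<beta>" and "0 \<le> a"
  shows "(\<forall>\<alpha><0. Delta_exists d \<beta> \<alpha> \<and> Delta_CMF_exists d \<beta> \<alpha> a
            \<and> Delta d \<beta> \<alpha> = 0 \<and> Delta_CMF d \<beta> \<alpha> a = 0)
       \<and> Delta_exists d \<beta> 0 \<and> Delta_CMF_exists d \<beta> 0 a
       \<and> Delta d \<beta> 0 = (if d \<le> 2 then \<infinity> else 0)
       \<and> Delta_CMF d \<beta> 0 a = (if d \<le> 2 then \<infinity> else 0)"
  using assms
  by (auto simp: Delta_eq Delta_CMF_eq summable_real_mult_q_neg summable_real_mult_q_zero)

end
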